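(* Let $\kappa>0$ be a real number and define $$g_{\kappa}(y):=\frac{1}{1+e^{-(\kappa-1)y}},\quad y\in\mathbb{R}.$$ (i) If $\kappa<1$, then $\inf_{y\in\mathbb{R}}g_{\kappa}(y)=\lim_{y\to\infty}g_{\kappa}(y)=0$. (ii) If $\kappa>1$, then $\inf_{y\in\mathbb{R}}g_{\kappa}(y)=\lim_{y\to-\infty}g_{\kappa}(y)=0$. (iii) If $\kappa=1$, then $g_{\kappa}(y)=\frac12$ for all $y\in\mathbb{R}$.
   Context: Origin of $g_\kappa$: if $X_{\mu,\beta}$ is a logistic random variable with parameters $\mu\in\mathbb{R},\beta>0$, i.e. with distribution function $P(X_{\mu,\beta}\leq x)=\frac{1}{1+e^{-(x-\mu)/\beta}}$, $x\in\mathbb{R}$, whose expectation is $\mu$, then $P(X_{\mu,\beta}\leq\kappa E[X_{\mu,\beta}])=g_\kappa(\mu/\beta)$. *)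

theory Defs
  imports Complex_Main
begin

definition g :: "real \<Rightarrow> real \<Rightarrow> real" where
  "g \<kappa> y = 1 / (1 + exp (- (\<kappa> - 1) * y))"

end

theory Submission
  imports Defs
begin

text \<open>All values of \<open>g \<kappa>\<close> are nonnegative, and the denominator blows up
  wherever the exponent \<open>- (\<kappa> - 1) * y\<close> tends to infinity: at
  \<open>at_top\<close> for \<kappa> < 1, at \<open>at_bot\<close> for \<kappa> > 1
  (\<open>g_tendsto_0\<close>). A lower bound that is also a limit of values is the infimum
  (\<open>INF_eq_lower_bound_of_tendsto\<close>). For \<kappa> = 1 the exponent vanishes.\<close>

text \<open>The infimum lies below every value of \<open>f\<close>, and such bounds pass to limits
  along a nontrivial filter, so it cannot exceed \<open>l\<close>.\<close>

lemma INF_eq_lower_bound_of_tendsto: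
  fixes f :: "'a \<Rightarrow> real"
  assumes lower: "\<And>x. l \<le> f x" and lim: "(f \<longlongrightarrow> l) F" and "F \<noteq> bot"
  shows "(INF x. f x) = l"
proof (rule antisym)
  have "bdd_below (range f)"
    using lower by (rule bdd_belowI2)
  then have "(INF x. f x) \<le> f y" for y
    by (simp add: cINF_lower)
  then show "(INF x. f x) \<le> l"
    using tendsto_lowerbound[OF lim] \<open>F \<noteq> bot\<close> by simp
  show "l \<le> (INF x. f x)"
    using lower by (simp add: cINF_greatest)
qed

lemma g_nonneg: "0 \<le> g \<kappa> y"
  by (simp add: g_def add_nonneg_nonneg)

text \<open>On the reals \<open>INF\<close> is a genuine infimum only for sets bounded below, so the
  theorem asserts this bound next to each value.\<close>

lemma bdd_below_range_g: "bdd_below (range (g \<kappa>))"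
  using g_nonneg by (rule bdd_belowI2)

text \<open>The filter is left arbitrary so that one argument serves both ends of the real
  line.\<close>

lemma g_tendsto_0:
  assumes "filterlim (\<lambda>y. - (\<kappa> - 1) * y) at_top F"
  shows "(g \<kappa> \<longlongrightarrow> 0) F"
proof -
  have "filterlim (\<lambda>y. 1 + exp (- (\<kappa> - 1) * y)) at_top F"
    by (intro filterlim_tendsto_add_at_top[OF tendsto_const]
        filterlim_compose[OF exp_at_top] assms)
  then show ?thesis
    unfolding g_def[abs_def]
    by (intro tendsto_divide_0[OF tendsto_const] filterlim_at_top_imp_at_infinity)
qed

theorem proposition3p3:
  fixes \<kappa> :: real
  assumes "\<kappa> > 0"
  shows "(\<kappa> < 1 \<longrightarrow>
            bdd_below (range (g \<kappa>)) \<and> (INF y. g \<kappa> y) = 0 \<and> (g \<kappa> \<longlongrightarrow> 0) at_top) \<and>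
         (\<kappa> > 1 \<longrightarrow>
            bdd_below (range (g \<kappa>)) \<and> (INF y. g \<kappa> y) = 0 \<and> (g \<kappa> \<longlongrightarrow> 0) at_bot) \<and>
         (\<kappa> = 1 \<longrightarrow> (\<forall>y. g \<kappa> y = 1 / 2))"
proof -
  have top: "(g \<kappa> \<longlongrightarrow> 0) at_top" if "\<kappa> < 1"
    \<comment> \<open>Here the constant factor \<open>- (\<kappa> - 1)\<close> is already
      positive.\<close>
    by (rule g_tendsto_0, rule filterlim_tendsto_pos_mult_at_top[OF tendsto_const])
      (use that in \<open>auto simp: filterlim_ident\<close>)
  have bot: "(g \<kappa> \<longlongrightarrow> 0) at_bot" if "\<kappa> > 1"
  proof (rule g_tendsto_0)
    \<comment> \<open>The minus sign moves onto \<open>y\<close>, leaving a positive constant times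
      a function that tends to infinity at \<open>at_bot\<close>.\<close>
    have "filterlim (\<lambda>y. (\<kappa> - 1) * - y) at_top at_bot"
      by (rule filterlim_tendsto_pos_mult_at_top[OF tendsto_const])
        (use that in \<open>auto simp: filterlim_uminus_at_top_at_bot\<close>)
    then show "filterlim (\<lambda>y. - (\<kappa> - 1) * y) at_top at_bot"
      by (simp only: mult_minus_left mult_minus_right)
  qed
  show ?thesis
    using top bot bdd_below_range_g
      INF_eq_lower_bound_of_tendsto[OF g_nonneg top]
      INF_eq_lower_bound_of_tendsto[OF g_nonneg bot]
    by (auto simp: g_def)
qed

end
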